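(* Let $E$ be a normed space, let $f\colon E\to E$, and let $p,q\in[1,+\infty)$. Assume that the composition operator $C_f$ maps $l^p(E)$ into $bv_q(E)$. Then $C_f\colon l^p(E)\to bv_q(E)$ is locally uniformly continuous if and only if for every $\varepsilon>0$ and $r>0$ there exist $\delta>0$ and constants $L_1,L_2,L_3\ge 0$ satisfying $(L_1^q+L_2^q)r^p\le\varepsilon^q$ such that for all $u,w\in\overline{B}_E(0,r)$ with $\|u-w\|\le\delta$ we have \[ \|f(u)-f(w)\|\le L_1\|u\|^{\frac pq}+L_2\|w\|^{\frac pq}+L_3\|u-w\|^{\frac pq}. \]
   Context: $E$ is a normed space over $\mathbb R$ or $\mathbb C$ with norm $\|\cdot\|$, and $\overline{B}_E(0,r)$ is its closed ball with center $0$ and radius $r$. For a map $f\colon E\to E$, the composition operator $C_f$ assigns to a sequence $x\colon\mathbb N\to E$ the sequence $C_f(x)$ with $C_f(x)(n)=f(x(n))$ for all $n\in\mathbb N$. $l^p(E)$ is the space of sequences $x\colon\mathbb N\to E$ with $\|x\|_{l^p}=\bigl(\sum_{n=1}^\infty\|x(n)\|^p\bigr)^{1/p}<+\infty$. $bv_q(E)$ is the space of all sequences $x\colon\mathbb N\to E$ with $\sum_{n=1}^\infty\|x(n+1)-x(n)\|^q<+\infty$, with norm $\|x\|_{bv_q}=\|x(1)\|+\bigl(\sum_{n=1}^\infty\|x(n+1)-x(n)\|^q\bigr)^{1/q}$. A map between normed spaces is called locally uniformly continuous if it is uniformly continuous on every bounded subset of its domain. *)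

theory Defs
  imports "HOL-Analysis.Analysis"
begin

text \<open>
  Sequences are indexed from 0, so the initial term of a sequence is \<open>x 0\<close>.
  The spaces depend on a real exponent, hence they are represented by a carrier set of
  sequences together with a norm function that is meaningful on that carrier.
  The type class \<^class>\<open>real_normed_vector\<close> also accounts for complex normed spaces: none of
  the notions below refers to the scalars.
\<close>

definition lp :: "real \<Rightarrow> (nat \<Rightarrow> 'a::real_normed_vector) set" where
  "lp p = {x. summable (\<lambda>n. norm (x n) powr p)}"

definition lp_norm :: "real \<Rightarrow> (nat \<Rightarrow> 'a::real_normed_vector) \<Rightarrow> real" where
  "lp_norm p x = (\<Sum>n. norm (x n) powr p) powr (1 / p)"

definition bv :: "real \<Rightarrow> (nat \<Rightarrow> 'a::real_normed_vector) set" where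
  "bv q = {x. summable (\<lambda>n. norm (x (Suc n) - x n) powr q)}"

definition bv_norm :: "real \<Rightarrow> (nat \<Rightarrow> 'a::real_normed_vector) \<Rightarrow> real" where
  "bv_norm q x = norm (x 0) + (\<Sum>n. norm (x (Suc n) - x n) powr q) powr (1 / q)"

definition composition_operator :: "('a \<Rightarrow> 'b) \<Rightarrow> (nat \<Rightarrow> 'a) \<Rightarrow> (nat \<Rightarrow> 'b)" where
  "composition_operator f x = (\<lambda>n. f (x n))"

definition norm_uniformly_continuous_on ::
    "'v::minus set \<Rightarrow> ('v \<Rightarrow> real) \<Rightarrow> ('w::minus \<Rightarrow> real) \<Rightarrow> ('v \<Rightarrow> 'w) \<Rightarrow> bool" where
  "norm_uniformly_continuous_on B N M F \<longleftrightarrow>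
     (\<forall>\<epsilon>>0. \<exists>\<delta>>0. \<forall>x\<in>B. \<forall>y\<in>B. N (x - y) < \<delta> \<longrightarrow> M (F x - F y) < \<epsilon>)"

text \<open>Here \<open>X\<close> with norm \<open>N\<close> is the domain, and \<open>M\<close> is the norm of the codomain.\<close>

definition locally_uniformly_continuous ::
    "'v::minus set \<Rightarrow> ('v \<Rightarrow> real) \<Rightarrow> ('w::minus \<Rightarrow> real) \<Rightarrow> ('v \<Rightarrow> 'w) \<Rightarrow> bool" where
  "locally_uniformly_continuous X N M F \<longleftrightarrow>
     (\<forall>B\<subseteq>X. (\<exists>R. \<forall>x\<in>B. N x \<le> R) \<longrightarrow> norm_uniformly_continuous_on B N M F)"

end

theory Submission imports Defs begin

text \<open>
  For necessity, test uniform continuity on the sequences that alternate between \<open>0\<close> and \<open>u\<close>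
  (respectively \<open>w\<close>) with \<open>k\<close> nonzero terms. The image difference then jumps by
  \<open>f u - f w\<close> exactly \<open>2 * k\<close> times, so that \<open>2 * k * \<parallel>f u - f w\<parallel>^q\<close> is small for the
  largest \<open>k\<close> keeping the sequences in the ball of radius \<open>r\<close> and close to each other; this
  \<open>k\<close> is comparable to the minimum of \<open>r^p / \<parallel>u\<parallel>^p\<close>, \<open>r^p / \<parallel>w\<parallel>^p\<close> and
  \<open>\<delta>^p / \<parallel>u - w\<parallel>^p\<close>. For sufficiency, the pointwise estimate is summed, and the
  \<open>bv q\<close> norm is dominated by the \<open>lp q\<close> norm.
\<close>

section \<open>Power inequalities and comparison of the sequence norms\<close>

lemma powr_add_le:
  fixes a b q :: real
  assumes "0 \<le> a" "0 \<le> b" "0 \<le> q"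
  shows "(a + b) powr q \<le> 2 powr q * (a powr q + b powr q)"
proof -
  \<comment> \<open>Bounding by the larger summand costs the constant \<open>2 powr q\<close>, but
    it works for every exponent \<open>q >= 0\<close> without convexity.\<close>
  have "(a + b) powr q \<le> (2 * max a b) powr q"
    using assms by (intro powr_mono2) auto
  also have "\<dots> = 2 powr q * max a b powr q"
    using assms by (simp add: powr_mult)
  also have "\<dots> \<le> 2 powr q * (a powr q + b powr q)"
    by (intro mult_left_mono) (auto simp: max_def)
  finally show ?thesis .
qed

lemma powr_add3_le:
  fixes a b c q :: real
  assumes "0 \<le> a" "0 \<le> b" "0 \<le> c" "0 \<le> q"
  shows "(a + b + c) powr q \<le> 3 powr q * (a powr q + b powr q + c powr q)"
proof -
  have "(a + b + c) powr q \<le> (3 * max a (max b c)) powr q"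
    using assms by (intro powr_mono2) auto
  also have "\<dots> = 3 powr q * max a (max b c) powr q"
    using assms by (simp add: powr_mult)
  also have "\<dots> \<le> 3 powr q * (a powr q + b powr q + c powr q)"
    by (intro mult_left_mono) (auto simp: max_def)
  finally show ?thesis .
qed

lemma norm_diff_powr_le:
  fixes a b :: "'a::real_normed_vector"
  assumes "0 \<le> q"
  shows "norm (a - b) powr q \<le> 2 powr q * (norm a powr q + norm b powr q)"
proof -
  have "norm (a - b) powr q \<le> (norm a + norm b) powr q"
    using assms by (intro powr_mono2 norm_triangle_ineq4) auto
  then show ?thesis
    using powr_add_le[of "norm a" "norm b" q] assms by simp
qed

lemma lp_diff:
  assumes "0 \<le> p" "x \<in> lp p" "y \<in> lp p"
  shows "x - y \<in> lp p"
proof -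
  have "summable (\<lambda>n. 2 powr p * (norm (x n) powr p + norm (y n) powr p))"
    using assms by (intro summable_mult summable_add) (auto simp: lp_def)
  then have "summable (\<lambda>n. norm ((x - y) n) powr p)"
    by (rule summable_comparison_test')
      (use norm_diff_powr_le[OF assms(1)] in auto)
  then show ?thesis by (simp add: lp_def)
qed

lemma lp_norm_nonneg: "0 \<le> lp_norm p x"
  by (simp add: lp_norm_def)

lemma lp_norm_powr:
  assumes "0 < p" "x \<in> lp p"
  shows "lp_norm p x powr p = (\<Sum>n. norm (x n) powr p)"
  using assms by (simp add: lp_norm_def powr_powr lp_def suminf_nonneg)

text \<open>A single term of a nonnegative series is at most its sum. This transfers bounds on whole
  sequences to their terms, where the pointwise estimate can be applied.\<close>

lemma norm_le_lp_norm:
  assumes "0 < p" "x \<in> lp p"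
  shows "norm (x n) \<le> lp_norm p x"
proof -
  have "norm (x n) powr p \<le> lp_norm p x powr p"
    unfolding lp_norm_powr[OF assms]
    using sum_le_suminf[of "\<lambda>n. norm (x n) powr p" "{n}"] assms(2) by (simp add: lp_def)
  then show ?thesis
    using assms(1) lp_norm_nonneg[of p x] by (meson not_le powr_less_mono2)
qed

text \<open>Each jump is controlled by its two neighbouring terms, which gives
  \<open>4 * lp_norm q z\<close> for the variation; the initial term adds at most one more
  \<open>lp_norm q z\<close>.\<close>

lemma bv_norm_le_lp_norm:
  assumes "1 \<le> q" "z \<in> lp q"
  shows "bv_norm q z \<le> 5 * lp_norm q z"
proof -
  define S where "S = (\<Sum>n. norm (z n) powr q)"
  have sz: "summable (\<lambda>n. norm (z n) powr q)"
    using assms(2) by (simp add: lp_def)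
  have sz': "summable (\<lambda>n. norm (z (Suc n)) powr q)"
    using sz by (subst summable_Suc_iff)
  have S0: "0 \<le> S"
    unfolding S_def by (intro suminf_nonneg sz) auto
  have tail: "(\<Sum>n. norm (z (Suc n)) powr q) \<le> S"
    unfolding S_def using suminf_split_head[OF sz] by simp
  have le: "norm (z (Suc n) - z n) powr q \<le> 2 powr q * (norm (z (Suc n)) powr q + norm (z n) powr q)"
    for n
    using norm_diff_powr_le[of q "z (Suc n)" "z n"] assms(1) by simp
  have sm: "summable (\<lambda>n. 2 powr q * (norm (z (Suc n)) powr q + norm (z n) powr q))"
    by (intro summable_mult summable_add sz sz')
  then have sd: "summable (\<lambda>n. norm (z (Suc n) - z n) powr q)"
    by (rule summable_comparison_test') (use le in auto)
  have "(\<Sum>n. norm (z (Suc n) - z n) powr q)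
      \<le> (\<Sum>n. 2 powr q * (norm (z (Suc n)) powr q + norm (z n) powr q))"
    by (intro suminf_le le sd sm)
  also have "\<dots> = 2 powr q * ((\<Sum>n. norm (z (Suc n)) powr q) + S)"
    unfolding S_def by (simp add: suminf_mult summable_add sz sz' suminf_add)
  also have "\<dots> \<le> 2 powr q * (2 * S)"
    using tail by (intro mult_left_mono) auto
  \<comment> \<open>Since \<open>q >= 1\<close>, the factor 2 is at most \<open>2 powr q\<close>;
    the constant becomes a pure power and leaves the root as 4.\<close>
  also have "\<dots> \<le> 2 powr q * (2 powr q * S)"
    using S0 powr_mono[of 1 q 2] assms(1) by (intro mult_left_mono mult_right_mono) auto
  also have "\<dots> = 4 powr q * S"
    using powr_mult[of 2 2 q] by simp
  finally have "(\<Sum>n. norm (z (Suc n) - z n) powr q) powr (1/q) \<le> (4 powr q * S) powr (1/q)"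
    using assms(1) by (intro powr_mono2 suminf_nonneg sd) auto
  also have "\<dots> = 4 * lp_norm q z"
    using assms(1) S0 by (simp add: powr_mult powr_powr lp_norm_def S_def)
  finally show ?thesis
    using norm_le_lp_norm[of q z 0] assms by (simp add: bv_norm_def)
qed

section \<open>Alternating test sequences\<close>

definition alternating_block :: "nat \<Rightarrow> 'a::zero \<Rightarrow> nat \<Rightarrow> 'a" where
  "alternating_block k a n = (if odd n \<and> n < 2 * k then a else 0)"

lemma sum_alternating_block:
  "(\<Sum>n<2 * k. alternating_block k (c::real) n) = real k * c"
proof -
  have "(\<Sum>n<2 * k. if odd n then c else 0) = real k * c"
    by (induction k) (auto simp: algebra_simps)
  moreover have "(\<Sum>n<2 * k. alternating_block k c n) = (\<Sum>n<2 * k. if odd n then c else 0)"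
    by (intro sum.cong) (auto simp: alternating_block_def)
  ultimately show ?thesis by simp
qed

lemma norm_alternating_block_sums:
  fixes a :: "'a::real_normed_vector"
  shows "(\<lambda>n. norm (alternating_block k a n) powr p) sums (real k * norm a powr p)"
proof -
  have "(\<lambda>n. norm (alternating_block k a n) powr p) = alternating_block k (norm a powr p)"
    by (auto simp: alternating_block_def)
  moreover have "alternating_block k (norm a powr p)
      sums (\<Sum>n<2 * k. alternating_block k (norm a powr p) n)"
    by (rule sums_finite) (auto simp: alternating_block_def)
  ultimately show ?thesis
    by (simp add: sum_alternating_block)
qed

lemma alternating_block_in_lp: "alternating_block k a \<in> lp p"
  using norm_alternating_block_sums[of k a p] by (auto simp: lp_def sums_iff)

lemma lp_norm_alternating_block:
  "lp_norm p (alternating_block k a) = (real k * norm a powr p) powr (1 / p)"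
  using norm_alternating_block_sums[of k a p] by (simp add: lp_norm_def sums_iff)

text \<open>The nonzero terms sit at odd indices, so the initial term is 0 and every nonzero term is
  both entered and left by a jump, the last one at index \<open>2 * k - 1\<close>. This yields
  \<open>2 * k\<close> jumps of size \<open>norm a\<close>.\<close>

lemma bv_norm_alternating_block:
  fixes a :: "'a::real_normed_vector"
  shows "bv_norm q (alternating_block k a) = (2 * real k * norm a powr q) powr (1 / q)"
proof -
  have "(\<lambda>n. norm (alternating_block k a (Suc n) - alternating_block k a n) powr q)
      = (\<lambda>n. if n < 2 * k then norm a powr q else 0)"
    by (rule ext) (auto simp: alternating_block_def elim!: oddE evenE)
  moreover have "(\<lambda>n. if n < 2 * k then norm a powr q else 0)
      sums (\<Sum>n<2 * k. if n < 2 * k then norm a powr q else 0)"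
    by (rule sums_finite) auto
  ultimately show ?thesis
    by (simp add: bv_norm_def sums_iff alternating_block_def)
qed

lemma alternating_block_diff:
  fixes a b :: "'a::group_add"
  shows "alternating_block k a - alternating_block k b = alternating_block k (a - b)"
  by (auto simp: alternating_block_def)

text \<open>Where both blocks vanish, both images equal \<open>f 0\<close> and cancel, whatever that
  value is.\<close>

lemma composition_alternating_block_diff:
  fixes f :: "'a::zero \<Rightarrow> 'b::group_add"
  shows "composition_operator f (alternating_block k u) - composition_operator f (alternating_block k w)
    = alternating_block k (f u - f w)"
  by (auto simp: composition_operator_def alternating_block_def)

section \<open>Necessity: from uniform continuity to the pointwise estimate\<close>

lemma mult_powr_root_le_iff:
  fixes b c p :: real
  assumes "0 < p" "0 \<le> b" "0 \<le> c"
  shows "b powr (1 / p) \<le> c \<longleftrightarrow> b \<le> c powr p"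
proof -
  have "b powr (1 / p) \<le> c \<longleftrightarrow> (b powr (1 / p)) powr p \<le> c powr p"
    using assms by (smt (verit) powr_ge_zero powr_less_mono2 powr_mono2)
  then show ?thesis
    using assms by (simp add: powr_powr)
qed

text \<open>Take the integer part of \<open>1 / M\<close>. As \<open>1 / M >= 1\<close>, rounding
  down loses at most a factor 2, because \<open>1 / M <= k + 1 <= 2 * k\<close>.\<close>

lemma obtain_comparable_nat:
  fixes M :: real
  assumes "0 < M" "M \<le> 1"
  obtains k :: nat where "real k * M \<le> 1" "1 \<le> 2 * real k * M"
proof
  define k where "k = nat \<lfloor>1 / M\<rfloor>"
  have "1 \<le> 1 / M"
    using assms by simp
  then have "1 \<le> \<lfloor>1 / M\<rfloor>" by simp
  then have k: "real k = of_int \<lfloor>1 / M\<rfloor>" "1 \<le> real k"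
    unfolding k_def by linarith+
  have "real k \<le> 1 / M" "1 / M \<le> real k + 1"
    unfolding k(1) by linarith+
  with k(2) have "real k \<le> 1 / M" "1 / M \<le> 2 * real k"
    by auto
  then show "real k * M \<le> 1" "1 \<le> 2 * real k * M"
    using assms by (auto simp: field_simps)
qed

lemma pointwise_bound_of_uniformly_continuous:
  fixes f :: "'a::real_normed_vector \<Rightarrow> 'b::real_normed_vector" and u w :: 'a
  assumes p: "1 \<le> p" and q: "1 \<le> q" and e: "0 < e" and r: "0 < r" and d: "0 < d"
    and uc: "\<And>x y. \<lbrakk>x \<in> lp p; y \<in> lp p; lp_norm p x \<le> r; lp_norm p y \<le> r; lp_norm p (x - y) \<le> d\<rbrakk>
      \<Longrightarrow> bv_norm q (composition_operator f x - composition_operator f y) \<le> e"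
    and uw: "norm u \<le> r" "norm w \<le> r" "norm (u - w) \<le> d"
  shows "norm (f u - f w) \<le> e / r powr (p / q) * norm u powr (p / q)
    + e / r powr (p / q) * norm w powr (p / q) + e / d powr (p / q) * norm (u - w) powr (p / q)"
proof (cases "u = w")
  case True
  then show ?thesis using e by simp
next
  case False
  define a where "a = norm u powr p / r powr p"
  define b where "b = norm w powr p / r powr p"
  define c where "c = norm (u - w) powr p / d powr p"
  define M where "M = max a (max b c)"
  \<comment> \<open>Because \<open>u\<close> and \<open>w\<close> differ, \<open>c\<close> and hence
    \<open>M\<close> is positive; the three norm bounds give \<open>M <= 1\<close>. Both are
    required to choose \<open>k\<close>.\<close>
  have c0: "0 < c"
    using False d by (simp add: c_def)
  have "a \<le> 1" "b \<le> 1" "c \<le> 1"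
    using uw p r d by (auto simp: a_def b_def c_def intro!: powr_mono2)
  then have M: "0 < M" "M \<le> 1" "a \<le> M" "b \<le> M" "c \<le> M"
    using c0 by (auto simp: M_def)
  obtain k :: nat where k: "real k * M \<le> 1" "1 \<le> 2 * real k * M"
    using obtain_comparable_nat M by blast
  have kM: "real k * t \<le> 1" if "t \<le> M" for t
    using mult_left_mono[OF that, of "real k"] k(1) by simp
  \<comment> \<open>The three claims are \<open>k * a <= 1\<close>, \<open>k * b <= 1\<close> and
    \<open>k * c <= 1\<close> after taking \<open>p\<close>-th powers.\<close>
  have "lp_norm p (alternating_block k u) \<le> r" "lp_norm p (alternating_block k w) \<le> r"
    "lp_norm p (alternating_block k (u - w)) \<le> d"
    unfolding lp_norm_alternating_block
    using kM[OF M(3)] kM[OF M(4)] kM[OF M(5)] p r d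
    by (simp_all add: mult_powr_root_le_iff a_def b_def c_def field_simps)
  then have "bv_norm q (alternating_block k (f u - f w)) \<le> e"
    using uc[OF alternating_block_in_lp alternating_block_in_lp, of k u k w]
    by (simp add: alternating_block_diff composition_alternating_block_diff)
  then have F: "2 * real k * norm (f u - f w) powr q \<le> e powr q"
    unfolding bv_norm_alternating_block using q e by (simp add: mult_powr_root_le_iff)
  \<comment> \<open>The two jumps per nonzero term offset the factor 2 lost in rounding, so the
    resulting bound \<open>M * e powr q\<close> carries no extra constant.\<close>
  have "norm (f u - f w) powr q \<le> (2 * real k * M) * norm (f u - f w) powr q"
    using mult_right_mono[OF k(2), of "norm (f u - f w) powr q"] by simp
  also have "\<dots> = M * (2 * real k * norm (f u - f w) powr q)"
    by simp
  also have "\<dots> \<le> M * e powr q"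
    using F M by (intro mult_left_mono) auto
  finally have "(norm (f u - f w) powr q) powr (1 / q) \<le> (M * e powr q) powr (1 / q)"
    using q by (intro powr_mono2) auto
  then have "norm (f u - f w) \<le> e * M powr (1 / q)"
    using q e M by (simp add: powr_mult powr_powr mult.commute)
  \<comment> \<open>The maximum is one of three nonnegative ratios, hence at most their sum; each
    ratio produces one term of the estimate.\<close>
  also have "\<dots> \<le> e * (a powr (1 / q) + b powr (1 / q) + c powr (1 / q))"
    using e by (intro mult_left_mono) (auto simp: M_def max_def)
  also have "\<dots> = e / r powr (p / q) * norm u powr (p / q)
    + e / r powr (p / q) * norm w powr (p / q) + e / d powr (p / q) * norm (u - w) powr (p / q)"
    using r d by (simp add: a_def b_def c_def powr_divide powr_powr algebra_simps)
  finally show ?thesis .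
qed

section \<open>Sufficiency: summing the pointwise estimate\<close>

lemma bv_norm_le_of_pointwise_bound:
  fixes f :: "'a::real_normed_vector \<Rightarrow> 'b::real_normed_vector"
  assumes p: "1 \<le> p" and q: "1 \<le> q" and e: "0 < e"
    and L: "0 \<le> L1" "0 \<le> L2" "0 \<le> L3"
    and Le: "(L1 powr q + L2 powr q) * R powr p \<le> e powr q"
    and bound: "\<And>u w. \<lbrakk>norm u \<le> R; norm w \<le> R; norm (u - w) \<le> d\<rbrakk> \<Longrightarrow>
      norm (f u - f w) \<le> L1 * norm u powr (p / q) + L2 * norm w powr (p / q)
        + L3 * norm (u - w) powr (p / q)"
    and x: "x \<in> lp p" "lp_norm p x \<le> R" and y: "y \<in> lp p" "lp_norm p y \<le> R"
    and xy: "lp_norm p (x - y) \<le> d" "L3 powr q * lp_norm p (x - y) powr p \<le> e powr q"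
  shows "bv_norm q (composition_operator f x - composition_operator f y) \<le> 30 * e"
proof -
  define z where "z = composition_operator f x - composition_operator f y"
  \<comment> \<open>Raising the pointwise estimate to the power \<open>q\<close> turns the exponent
    \<open>p / q\<close> into \<open>p\<close>, so \<open>h\<close> sums to a combination of
    \<open>p\<close>-th powers of \<open>lp_norm p\<close>.\<close>
  define h where "h n = 3 powr q * (L1 powr q * norm (x n) powr p + L2 powr q * norm (y n) powr p
    + L3 powr q * norm ((x - y) n) powr p)" for n
  have p0: "0 < p" and q0: "0 < q" using p q by auto
  have dxy: "x - y \<in> lp p" using lp_diff[OF _ x(1) y(1)] p0 by simp
  have zh: "norm (z n) powr q \<le> h n" for n
  proof -
    have "norm (x n) \<le> R" "norm (y n) \<le> R" "norm (x n - y n) \<le> d"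
      using norm_le_lp_norm[OF p0 x(1), of n] norm_le_lp_norm[OF p0 y(1), of n]
        norm_le_lp_norm[OF p0 dxy, of n] x(2) y(2) xy(1) by simp_all
    from bound[OF this] have "norm (z n) powr q \<le> (L1 * norm (x n) powr (p / q)
        + L2 * norm (y n) powr (p / q) + L3 * norm (x n - y n) powr (p / q)) powr q"
      using q0 by (intro powr_mono2) (auto simp: z_def composition_operator_def)
    also have "\<dots> \<le> h n"
      using powr_add3_le[of "L1 * norm (x n) powr (p / q)" "L2 * norm (y n) powr (p / q)"
          "L3 * norm (x n - y n) powr (p / q)" q] L q0
      by (simp add: h_def powr_mult powr_powr)
    finally show ?thesis .
  qed
  have s: "summable (\<lambda>n. norm (x n) powr p)" "summable (\<lambda>n. norm (y n) powr p)"
    "summable (\<lambda>n. norm ((x - y) n) powr p)"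
    using x y dxy by (auto simp only: lp_def mem_Collect_eq)
  have h: "h sums (3 powr q * (L1 powr q * lp_norm p x powr p + L2 powr q * lp_norm p y powr p
    + L3 powr q * lp_norm p (x - y) powr p))"
    unfolding h_def lp_norm_powr[OF p0 x(1)] lp_norm_powr[OF p0 y(1)] lp_norm_powr[OF p0 dxy]
    by (intro sums_mult sums_add summable_sums s)
  \<comment> \<open>The images themselves need not be \<open>q\<close>-summable, but their
    difference is.\<close>
  have sz: "summable (\<lambda>n. norm (z n) powr q)"
    by (rule summable_comparison_test'[OF sums_summable[OF h]]) (use zh in auto)
  then have z: "z \<in> lp q" by (simp add: lp_def)
  \<comment> \<open>The condition on \<open>L1\<close> and \<open>L2\<close> bounds these two terms
    by \<open>e powr q\<close>; closeness of \<open>x\<close> and \<open>y\<close> bounds the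
    \<open>L3\<close> term by another \<open>e powr q\<close>.\<close>
  have "L1 powr q * lp_norm p x powr p + L2 powr q * lp_norm p y powr p
      \<le> L1 powr q * R powr p + L2 powr q * R powr p"
    using x(2) y(2) p0 by (intro add_mono mult_left_mono powr_mono2 lp_norm_nonneg) auto
  also have "\<dots> \<le> e powr q"
    using Le by (simp add: algebra_simps)
  finally have "L1 powr q * lp_norm p x powr p + L2 powr q * lp_norm p y powr p
      + L3 powr q * lp_norm p (x - y) powr p \<le> 2 * e powr q"
    using xy(2) by linarith
  also have "\<dots> \<le> 2 powr q * e powr q"
    using powr_mono[of 1 q 2] q by (intro mult_right_mono) auto
  finally have "3 powr q * (L1 powr q * lp_norm p x powr p + L2 powr q * lp_norm p y powr p
      + L3 powr q * lp_norm p (x - y) powr p) \<le> 3 powr q * (2 powr q * e powr q)"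
    by (intro mult_left_mono) auto
  moreover have "3 powr q * (2 powr q * e powr q) = (6 * e) powr q"
    using e powr_mult[of 3 2 q] by (simp add: powr_mult)
  moreover have "(\<Sum>n. norm (z n) powr q) \<le> suminf h"
    by (intro suminf_le zh sz sums_summable[OF h])
  ultimately have "(\<Sum>n. norm (z n) powr q) \<le> (6 * e) powr q"
    using sums_unique[OF h] by linarith
  then have "lp_norm q z \<le> 6 * e"
    unfolding lp_norm_def using q0 e
    by (subst mult_powr_root_le_iff) (auto intro: suminf_nonneg sz)
  \<comment> \<open>The constant 30 is 3 for splitting three summands, times 2 for the two
    contributions \<open>e powr q\<close>, times 5 for passing from \<open>lp_norm q\<close> to
    \<open>bv_norm q\<close>.\<close>
  then show ?thesis
    using bv_norm_le_lp_norm[OF q z] by (simp add: z_def)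
qed

section \<open>The equivalence: choice of constants in both directions\<close>

theorem theorem16:
  fixes f :: "'a::real_normed_vector \<Rightarrow> 'a" and p q :: real
  assumes "1 \<le> p" and "1 \<le> q"
    and "composition_operator f \<in> lp p \<rightarrow> bv q"
  shows "locally_uniformly_continuous (lp p) (lp_norm p) (bv_norm q) (composition_operator f)
    \<longleftrightarrow> (\<forall>\<epsilon>>0. \<forall>r>0. \<exists>\<delta>>0. \<exists>L1\<ge>0. \<exists>L2\<ge>0. \<exists>L3\<ge>0.
          (L1 powr q + L2 powr q) * r powr p \<le> \<epsilon> powr q \<and>
          (\<forall>u\<in>cball 0 r. \<forall>w\<in>cball 0 r. norm (u - w) \<le> \<delta> \<longrightarrow>
             norm (f u - f w) \<le> L1 * norm u powr (p / q) + L2 * norm w powr (p / q)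
                                + L3 * norm (u - w) powr (p / q)))"
  (is "?luc \<longleftrightarrow> ?bound")
proof
  assume luc: ?luc
  show ?bound
  proof (intro allI impI)
    fix \<epsilon> r :: real
    assume \<epsilon>: "0 < \<epsilon>" and r: "0 < r"
    define B :: "(nat \<Rightarrow> 'a) set" where "B = {x \<in> lp p. lp_norm p x \<le> r}"
    have "norm_uniformly_continuous_on B (lp_norm p) (bv_norm q) (composition_operator f)"
      using luc[unfolded locally_uniformly_continuous_def, rule_format, of B] by (auto simp: B_def)
    then obtain d where d: "0 < d" and uc: "\<And>x y. \<lbrakk>x \<in> B; y \<in> B; lp_norm p (x - y) < d\<rbrakk>
      \<Longrightarrow> bv_norm q (composition_operator f x - composition_operator f y) < \<epsilon> / 2"
      using half_gt_zero[OF \<epsilon>] unfolding norm_uniformly_continuous_on_def by metis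
    \<comment> \<open>With tolerance \<open>\<epsilon> / 2\<close>, two equal constants give
      \<open>2 * (\<epsilon> / 2) powr q <= \<epsilon> powr q\<close>, as \<open>q >= 1\<close>.
      Halving \<open>d\<close> below turns the strict inequality of uniform continuity into a weak
      one.\<close>
    define L where "L = \<epsilon> / 2 / r powr (p / q)"
    define L3 where "L3 = \<epsilon> / 2 / (d / 2) powr (p / q)"
    have "norm (f u - f w) \<le> L * norm u powr (p / q) + L * norm w powr (p / q)
        + L3 * norm (u - w) powr (p / q)"
      if "norm u \<le> r" "norm w \<le> r" "norm (u - w) \<le> d / 2" for u w
      unfolding L_def L3_def
    proof (rule pointwise_bound_of_uniformly_continuous[OF assms(1,2) _ r _ _ that])
      fix x y :: "nat \<Rightarrow> 'a"
      assume "x \<in> lp p" "y \<in> lp p" "lp_norm p x \<le> r" "lp_norm p y \<le> r"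
        and "lp_norm p (x - y) \<le> d / 2"
      then show "bv_norm q (composition_operator f x - composition_operator f y) \<le> \<epsilon> / 2"
        using uc[of x y] d by (simp add: B_def)
    qed (use d \<epsilon> in auto)
    moreover have "(L powr q + L powr q) * r powr p \<le> \<epsilon> powr q"
    proof -
      have "L powr q * r powr p = (\<epsilon> / 2) powr q"
        using assms(2) r \<epsilon> by (simp add: L_def powr_divide powr_mult powr_powr)
      moreover have "2 * (\<epsilon> / 2) powr q \<le> 2 powr q * (\<epsilon> / 2) powr q"
        using powr_mono[of 1 q 2] assms(2) by (intro mult_right_mono) auto
      moreover have "2 powr q * (\<epsilon> / 2) powr q = \<epsilon> powr q"
        using \<epsilon> powr_mult[of 2 "\<epsilon> / 2" q] by simp
      ultimately show ?thesis
        by (simp add: distrib_right)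
    qed
    moreover have "0 \<le> L" "0 \<le> L3" "0 < d / 2"
      using \<epsilon> d by (auto simp: L_def L3_def)
    ultimately show "\<exists>\<delta>>0. \<exists>L1\<ge>0. \<exists>L2\<ge>0. \<exists>L3\<ge>0.
          (L1 powr q + L2 powr q) * r powr p \<le> \<epsilon> powr q \<and>
          (\<forall>u\<in>cball 0 r. \<forall>w\<in>cball 0 r. norm (u - w) \<le> \<delta> \<longrightarrow>
             norm (f u - f w) \<le> L1 * norm u powr (p / q) + L2 * norm w powr (p / q)
                                + L3 * norm (u - w) powr (p / q))"
      unfolding Ball_def mem_cball_0 by blast
  qed
next
  assume bound: ?bound
  show ?luc
    unfolding locally_uniformly_continuous_def norm_uniformly_continuous_on_def
  proof (intro allI impI)
    fix B :: "(nat \<Rightarrow> 'a) set" and \<epsilon> :: real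
    assume B: "B \<subseteq> lp p" "\<exists>R. \<forall>x\<in>B. lp_norm p x \<le> R" and \<epsilon>: "0 < \<epsilon>"
    then obtain R0 where "\<forall>x\<in>B. lp_norm p x \<le> R0" by blast
    \<comment> \<open>The pointwise condition concerns positive radii, so the bound is raised to at
      least 1.\<close>
    then obtain R where R: "0 < R" "\<forall>x\<in>B. lp_norm p x \<le> R"
      by (intro that[of "max 1 R0"]) (auto simp: le_max_iff_disj)
    \<comment> \<open>The summed estimate yields \<open>30 * e\<close>, which must be strictly below
      \<open>\<epsilon>\<close>.\<close>
    define e where "e = \<epsilon> / 31"
    have e: "0 < e" using \<epsilon> by (simp add: e_def)
    from bound[rule_format, OF e R(1)] obtain d L1 L2 L3 where d: "0 < d"
      and L: "0 \<le> L1" "0 \<le> L2" "0 \<le> L3"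
      and Le: "(L1 powr q + L2 powr q) * R powr p \<le> e powr q"
      and pw: "\<And>u w. \<lbrakk>norm u \<le> R; norm w \<le> R; norm (u - w) \<le> d\<rbrakk> \<Longrightarrow>
        norm (f u - f w) \<le> L1 * norm u powr (p / q) + L2 * norm w powr (p / q)
          + L3 * norm (u - w) powr (p / q)"
      unfolding Ball_def mem_cball_0 by blast
    \<comment> \<open>Chosen so that \<open>L3 powr q * d' powr p <= e powr q\<close>; adding 1
      keeps the denominator positive when \<open>L3 = 0\<close>.\<close>
    define d' where "d' = (e / (L3 + 1)) powr (q / p)"
    have d': "0 < d'" using e L by (simp add: d'_def)
    have "bv_norm q (composition_operator f x - composition_operator f y) < \<epsilon>"
      if "x \<in> B" "y \<in> B" "lp_norm p (x - y) < min d d'" for x y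
    proof -
      have "L3 powr q * lp_norm p (x - y) powr p \<le> L3 powr q * d' powr p"
        using that assms(1) by (intro mult_left_mono powr_mono2 lp_norm_nonneg) auto
      also have "d' powr p = (e / (L3 + 1)) powr q"
        using assms(1) by (simp add: d'_def powr_powr)
      also have "L3 powr q * (e / (L3 + 1)) powr q = (L3 * (e / (L3 + 1))) powr q"
        using powr_mult[of L3 "e / (L3 + 1)" q] L e by simp
      also have "\<dots> \<le> e powr q"
        using L e assms(2) by (intro powr_mono2) (auto simp: field_simps)
      finally have L3: "L3 powr q * lp_norm p (x - y) powr p \<le> e powr q" .
      have "x \<in> lp p" "lp_norm p x \<le> R" "y \<in> lp p" "lp_norm p y \<le> R" "lp_norm p (x - y) \<le> d"
        using that B(1) R(2) by auto
      from bv_norm_le_of_pointwise_bound[OF assms(1,2) e L Le pw this L3]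
      have "bv_norm q (composition_operator f x - composition_operator f y) \<le> 30 * e"
        by simp
      then show ?thesis using \<epsilon> by (simp add: e_def)
    qed
    then show "\<exists>\<delta>>0. \<forall>x\<in>B. \<forall>y\<in>B. lp_norm p (x - y) < \<delta>
        \<longrightarrow> bv_norm q (composition_operator f x - composition_operator f y) < \<epsilon>"
      using d d' by (intro exI[of _ "min d d'"]) auto
  qed
qed

end
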